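(* There exist a strongly equitably 2-chromatic $P_4$ system $(V,\mathcal B)$ of order 28 and two distinct vertices $x,y\in V$ such that $x$ and $y$ receive different colours in every 2-colouring of $(V,\mathcal B)$.
   Context: $P_4=(a_1,a_2,a_3,a_4)$ denotes the path on four distinct vertices with edges $\{a_1,a_2\},\{a_2,a_3\},\{a_3,a_4\}$. A $P_4$ system of order $n>1$ is a pair $(V,\mathcal B)$ where $|V|=n$ and $\mathcal B$ is a set of $P_4$ paths with vertices in $V$ whose edge sets partition the edge set of the complete graph on $V$. A $k$-colouring of $(V,\mathcal B)$ is an assignment of one of $k$ colours to each vertex of $V$ such that no path in $\mathcal B$ is monochromatic. The system is $k$-colourable if it has a $k$-colouring, and $k$-chromatic if it is $k$-colourable but not $(k-1)$-colourable. A colouring is strongly equitable if all colour classes have the same size. The system is strongly equitably $k$-chromatic if it is $k$-chromatic and admits a strongly equitable $k$-colouring. *)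

theory Defs
  imports Main "HOL-Library.FuncSet" "HOL-Library.Disjoint_Sets"
begin

text \<open>
  The path \<open>(a1, a2, a3, a4)\<close> is represented by listing its vertices in order. A tuple and its
  reversal denote the same path; see \<open>P4_system\<close> below.
\<close>

type_synonym 'a path4 = "'a \<times> 'a \<times> 'a \<times> 'a"

fun path_verts :: "'a path4 \<Rightarrow> 'a set" where
  "path_verts (a1, a2, a3, a4) = {a1, a2, a3, a4}"

fun path_edges :: "'a path4 \<Rightarrow> 'a set set" where
  "path_edges (a1, a2, a3, a4) = {{a1, a2}, {a2, a3}, {a3, a4}}"

fun is_P4 :: "'a path4 \<Rightarrow> bool" where
  "is_P4 (a1, a2, a3, a4) \<longleftrightarrow> distinct [a1, a2, a3, a4]"

definition complete_edges :: "'a set \<Rightarrow> 'a set set" where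
  "complete_edges V = {e. e \<subseteq> V \<and> card e = 2}"

text \<open>
  The condition \<open>inj_on path_edges B\<close> says that the edge sets of distinct members of \<open>B\<close> are
  distinct, so that the blocks of the partition correspond one-to-one to the members of \<open>B\<close>. In
  particular no path is listed twice, once in each direction.
\<close>

definition P4_system :: "nat \<Rightarrow> 'a set \<Rightarrow> 'a path4 set \<Rightarrow> bool" where
  "P4_system n V B \<longleftrightarrow>
     n > 1 \<and> finite V \<and> card V = n \<and>
     (\<forall>p\<in>B. is_P4 p \<and> path_verts p \<subseteq> V) \<and>
     inj_on path_edges B \<and> partition_on (complete_edges V) (path_edges ` B)"

definition monochromatic :: "('a \<Rightarrow> nat) \<Rightarrow> 'a path4 \<Rightarrow> bool" where
  "monochromatic c p \<longleftrightarrow> (\<exists>i. \<forall>v\<in>path_verts p. c v = i)"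

text \<open>The colours are \<open>0, \<dots>, k - 1\<close>; not all of them need to be used.\<close>

definition colouring :: "nat \<Rightarrow> 'a set \<Rightarrow> 'a path4 set \<Rightarrow> ('a \<Rightarrow> nat) \<Rightarrow> bool" where
  "colouring k V B c \<longleftrightarrow> c \<in> V \<rightarrow> {..<k} \<and> (\<forall>p\<in>B. \<not> monochromatic c p)"

definition colourable :: "nat \<Rightarrow> 'a set \<Rightarrow> 'a path4 set \<Rightarrow> bool" where
  "colourable k V B \<longleftrightarrow> (\<exists>c. colouring k V B c)"

definition chromatic :: "nat \<Rightarrow> 'a set \<Rightarrow> 'a path4 set \<Rightarrow> bool" where
  "chromatic k V B \<longleftrightarrow> colourable k V B \<and> \<not> colourable (k - 1) V B"

definition colour_class :: "'a set \<Rightarrow> ('a \<Rightarrow> nat) \<Rightarrow> nat \<Rightarrow> 'a set" where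
  "colour_class V c i = {v \<in> V. c v = i}"

definition strongly_equitable :: "nat \<Rightarrow> 'a set \<Rightarrow> ('a \<Rightarrow> nat) \<Rightarrow> bool" where
  "strongly_equitable k V c \<longleftrightarrow>
     (\<forall>i<k. \<forall>j<k. card (colour_class V c i) = card (colour_class V c j))"

definition strongly_equitably_chromatic :: "nat \<Rightarrow> 'a set \<Rightarrow> 'a path4 set \<Rightarrow> bool" where
  "strongly_equitably_chromatic k V B \<longleftrightarrow>
     chromatic k V B \<and> (\<exists>c. colouring k V B c \<and> strongly_equitable k V c)"

end

theory Submission
  imports Defs "HOL-Library.Code_Binary_Nat"
begin

text \<open>
  Write vertex \<open>7 l + i\<close> as \<open>(l, i) \<in> {0, 1, 2, 3} \<times> \<int>\<^sub>7\<close>. Eighteen base paths whose 54 edges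
  represent the 54 orbits of edges under \<open>(l, i) \<mapsto> (l, i + 1)\<close> are rotated through \<open>\<int>\<^sub>7\<close>. No base
  path lies within levels \<open>{0, 1}\<close> or within levels \<open>{2, 3}\<close>, so these two halves form a strongly
  equitable 2-colouring. The base paths come from a computer search that minimised the case
  analysis refuting a 2-colouring in which \<open>0\<close> and \<open>24\<close> agree: five cases suffice, each of them
  settled by unit propagation.
\<close>

subsection \<open>Path systems given by lists\<close>

text \<open>With the smaller endpoint first, each edge is a single pair, so edges can be counted in
  a list and disjointness of paths read off from \<open>distinct\<close>.\<close>

fun ordered_edges :: "nat path4 \<Rightarrow> (nat \<times> nat) list" where
  "ordered_edges (a, b, c, d) = [(min a b, max a b), (min b c, max b c), (min c d, max c d)]"

lemma path_edges_eq_ordered_edges: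
  "path_edges p = (\<lambda>(i, j). {i, j}) ` set (ordered_edges p)"
  by (cases p) (auto simp: min_def max_def)

text \<open>
  Since the number of edges is right, covering every pair already forces the paths to be
  edge-disjoint.
\<close>

lemma P4_systemI:
  fixes ps :: "nat path4 list"
  assumes n: "n > 1"
    and verts: "\<forall>p\<in>set ps. is_P4 p \<and> path_verts p \<subseteq> {..<n}"
    and cover: "\<And>i j. i < j \<Longrightarrow> j < n \<Longrightarrow> (i, j) \<in> set (concat (map ordered_edges ps))"
    and len: "3 * length ps = n choose 2"
  shows "P4_system n {..<n} (set ps)"
proof -
  define e :: "nat \<times> nat \<Rightarrow> nat set" where "e = (\<lambda>(i, j). {i, j})"
  define es where "es = concat (map ordered_edges ps)"
  have edges: "path_edges p = e ` set (ordered_edges p)" for p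
    by (simp add: e_def path_edges_eq_ordered_edges)
  have es: "i < j \<and> j < n" if "(i, j) \<in> set es" for i j
    using that verts by (fastforce simp: es_def min_def max_def split: if_splits)
  have inj: "inj_on e (set es)"
    by (rule inj_onI) (auto simp: e_def doubleton_eq_iff dest!: es)
  have "complete_edges {..<n} \<subseteq> e ` set es"
  proof
    fix x assume "x \<in> complete_edges {..<n}"
    then obtain a b where "x = {a, b}" "a \<noteq> b" "a < n" "b < n"
      by (auto simp: complete_edges_def card_2_iff)
    moreover define i j where "i = min a b" and "j = max a b"
    ultimately have "x = {i, j}" "i < j" "j < n"
      by (auto simp: min_def max_def)
    then show "x \<in> e ` set es"
      using cover by (force simp: e_def es_def)
  qed
  moreover have "e ` set es \<subseteq> complete_edges {..<n}"
    using es by (fastforce simp: e_def complete_edges_def)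
  ultimately have image: "e ` set es = complete_edges {..<n}"
    by blast
  have "length es = 3 * length ps"
    unfolding es_def by (induction ps) auto
  also have "\<dots> = card (complete_edges {..<n})"
    using len n_subsets[of "{..<n}" 2] by (simp add: complete_edges_def)
  also have "\<dots> = card (set es)"
    by (simp add: card_image[OF inj] flip: image)
  finally have dist: "distinct es"
    by (simp add: card_distinct)
  have nonempty: "path_edges p \<noteq> {}" for p :: "nat path4"
    by (cases p) auto
  have disj: "path_edges p \<inter> path_edges q = {}"
    if pq: "p \<in> set ps" "q \<in> set ps" "p \<noteq> q" for p q
  proof -
    \<comment> \<open>\<open>distinct_concat_iff\<close> ignores empty lists when it infers that the
      concatenated lists differ; every path contributes three pairs, so nothing is ignored
      here.\<close>
    have "removeAll [] (map ordered_edges ps) = map ordered_edges ps"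
      by (rule removeAll_id) (auto elim: ordered_edges.elims)
    then have "distinct (map ordered_edges ps)"
      using dist by (simp add: es_def distinct_concat_iff)
    then have "ordered_edges p \<noteq> ordered_edges q"
      using pq by (auto simp: distinct_map dest: inj_onD)
    then have "set (ordered_edges p) \<inter> set (ordered_edges q) = {}"
      using pq dist by (simp add: es_def distinct_concat_iff)
    moreover have "set (ordered_edges p) \<subseteq> set es" "set (ordered_edges q) \<subseteq> set es"
      using pq by (auto simp: es_def)
    ultimately show ?thesis
      by (simp add: edges inj_on_image_Int[OF inj, symmetric])
  qed
  have "\<Union> (path_edges ` set ps) = complete_edges {..<n}"
    by (auto simp: es_def edges simp flip: image)
  moreover have "disjoint (path_edges ` set ps)"
  proof (rule disjointI)
    fix P Q
    assume "P \<in> path_edges ` set ps" "Q \<in> path_edges ` set ps" "P \<noteq> Q"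
    then obtain p q where "P = path_edges p" "Q = path_edges q" "p \<in> set ps" "q \<in> set ps" "p \<noteq> q"
      by blast
    then show "P \<inter> Q = {}"
      using disj by simp
  qed
  moreover have "{} \<notin> path_edges ` set ps"
    using nonempty by force
  ultimately have "partition_on (complete_edges {..<n}) (path_edges ` set ps)"
    by (simp add: partition_on_def)
  moreover have "inj_on path_edges (set ps)"
    using disj nonempty by (metis inf.idem inj_onI)
  ultimately show ?thesis
    using n verts by (simp add: P4_system_def)
qed

text \<open>
  An executable form of the covering condition, sorting the pairs into buckets to avoid the
  quadratic number of comparisons of a direct membership test.
\<close>

definition covers_pairs :: "nat \<Rightarrow> (nat \<times> nat) list \<Rightarrow> bool" where
  "covers_pairs n es \<longleftrightarrow>
     list_all (\<lambda>j. sort (map fst (filter (\<lambda>(i, k). k = j) es)) = [0..<j]) [0..<n]"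

lemma covers_pairsD:
  assumes "covers_pairs n es" "i < j" "j < n"
  shows "(i, j) \<in> set es"
proof -
  have "sort (map fst (filter (\<lambda>(i, k). k = j) es)) = [0..<j]"
    using assms by (simp add: covers_pairs_def list_all_iff)
  from arg_cong[OF this, of set] show ?thesis
    using assms(2) by force
qed

text \<open>A path becomes two propositional clauses, with \<open>Q\<close> marking one of the two
  colour classes; this suits both evaluation and unit propagation.\<close>

fun not_all_equal :: "('a \<Rightarrow> bool) \<Rightarrow> 'a path4 \<Rightarrow> bool" where
  "not_all_equal Q (a, b, c, d) \<longleftrightarrow>
     \<not> (Q a \<and> Q b \<and> Q c \<and> Q d) \<and> (Q a \<or> Q b \<or> Q c \<or> Q d)"

text \<open>Only one colour remains besides that of \<open>x\<close>, so vertices that differ from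
  \<open>x\<close> agree with each other. Comparison with \<open>x\<close> avoids a case split on
  its colour.\<close>

lemma colouring_2_not_all_equal:
  assumes "colouring 2 V B c" "x \<in> V" "p \<in> B" "path_verts p \<subseteq> V"
  shows "not_all_equal (\<lambda>v. c v = c x) p"
proof -
  obtain a1 a2 a3 a4 where p: "p = (a1, a2, a3, a4)"
    by (cases p) auto
  have V: "{x, a1, a2, a3, a4} \<subseteq> V"
    using assms p by simp
  have other: "c v = c w" if "c v \<noteq> c x" "c w \<noteq> c x" "v \<in> V" "w \<in> V" for v w
  proof -
    have "c v < 2" "c w < 2" "c x < 2"
      using assms(1,2) that by (auto simp: colouring_def)
    then show ?thesis
      using that by linarith
  qed
  have "\<not> monochromatic c p"
    using assms by (simp add: colouring_def)
  then have nm: "\<not> (\<exists>i. c a1 = i \<and> c a2 = i \<and> c a3 = i \<and> c a4 = i)"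
    by (simp add: monochromatic_def p)
  have "c a1 = c x \<or> c a2 = c x \<or> c a3 = c x \<or> c a4 = c x"
  proof (rule ccontr)
    assume none: "\<not> ?thesis"
    have "c v = c a1" if "v \<in> {a2, a3, a4}" for v
      by (rule other) (use that none V in auto)
    then show False
      using nm by simp
  qed
  then show ?thesis
    using nm by (auto simp: p)
qed

text \<open>Two vertices span an edge, so there is at least one path, and a single colour makes it
  monochromatic.\<close>

lemma not_1_colourable:
  assumes "P4_system n V B"
  shows "\<not> colourable 1 V B"
proof
  assume "colourable 1 V B"
  then obtain c where c: "colouring 1 V B c"
    by (auto simp: colourable_def)
  have "complete_edges V \<noteq> {}"
  proof -
    have "card V \<ge> 2"
      using assms by (simp add: P4_system_def)
    then obtain e where "e \<subseteq> V" "card e = 2"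
      by (metis obtain_subset_with_card_n)
    then show ?thesis
      by (auto simp: complete_edges_def)
  qed
  then obtain p where p: "p \<in> B"
    using assms unfolding P4_system_def partition_on_def by blast
  then have "path_verts p \<subseteq> V"
    using assms by (auto simp: P4_system_def)
  then have "\<forall>v\<in>path_verts p. c v = 0"
    using c by (auto simp: colouring_def)
  then have "monochromatic c p"
    by (auto simp: monochromatic_def)
  then show False
    using c p by (simp add: colouring_def)
qed

subsection \<open>The system of order 28\<close>

fun rotate_path :: "nat \<Rightarrow> nat path4 \<Rightarrow> nat path4" where
  "rotate_path k (a, b, c, d) =
     (let r = (\<lambda>v. 7 * (v div 7) + (v mod 7 + k) mod 7) in (r a, r b, r c, r d))"

definition base_paths :: "nat path4 list" where
  "base_paths =
   [(25, 7, 1, 26), (11, 21, 15, 14), (1, 14, 19, 13), (4, 21, 18, 22), (5, 7, 13, 20),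
    (12, 14, 18, 27), (13, 14, 22, 24), (6, 14, 4, 7), (3, 7, 19, 26), (6, 21, 8, 23),
    (3, 14, 11, 6), (18, 7, 10, 22), (14, 0, 4, 24), (0, 7, 12, 26), (2, 14, 26, 27),
    (2, 0, 26, 3), (1, 0, 21, 24), (16, 0, 8, 24)]"

definition paths28 :: "nat path4 list" where
  "paths28 = [rotate_path k p. k \<leftarrow> [0..<7], p \<leftarrow> base_paths]"

lemma paths28_verts: "\<forall>p\<in>set paths28. is_P4 p \<and> path_verts p \<subseteq> {..<28}"
proof -
  have "list_all (\<lambda>p. is_P4 p \<and> (case p of (a, b, c, d) \<Rightarrow> a < 28 \<and> b < 28 \<and> c < 28 \<and> d < 28))
          paths28"
    by code_simp
  then show ?thesis
    by (auto simp: list_all_iff)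
qed

lemma paths28_system: "P4_system 28 {..<28} (set paths28)"
proof (rule P4_systemI[OF _ paths28_verts])
  have "covers_pairs 28 (concat (map ordered_edges paths28))"
    by code_simp
  then show "(i, j) \<in> set (concat (map ordered_edges paths28))" if "i < j" "j < 28" for i j
    using that by (rule covers_pairsD)
next
  \<comment> \<open>Seven rotations of 18 base paths give 126 paths, hence 378 edges.\<close>
  show "3 * length paths28 = 28 choose 2"
    by code_simp
qed simp

lemma paths28_colouring:
  "colouring 2 {..<28} (set paths28) (\<lambda>v. if v < 14 then 0 else 1)"
proof -
  have "list_all (not_all_equal (\<lambda>v. v < 14)) paths28"
    by code_simp
  then have "\<not> monochromatic (\<lambda>v. if v < 14 then 0 else 1) p" if "p \<in> set paths28" for p
    using that by (cases p) (auto simp: list_all_iff monochromatic_def split: if_splits)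
  then show ?thesis
    by (auto simp: colouring_def)
qed

text \<open>
  In each of the five cases the listed paths are ordered such that every path but the last
  determines the one of its vertices that is still undecided; the last path then has all its
  vertices on the same side.
\<close>

lemma paths28_separates_0_24:
  assumes nae: "\<And>p. p \<in> set paths28 \<Longrightarrow> not_all_equal Q p" and "Q 0"
  shows "\<not> Q 24"
proof
  assume "Q 24"
  \<comment> \<open>Membership of the selected paths is evaluated, so that only their clauses, not
    those of all 126 paths, reach \<open>auto\<close>.\<close>
  have refutes: "list_all (not_all_equal Q) qs" if "list_all (\<lambda>q. List.member paths28 q) qs" for qs
    using that nae by (simp add: list_all_iff)
  \<comment> \<open>The cases form a single chain: each refuted assumption is negated and kept as a
    fact for the later cases, and the last case needs no further assumption.\<close>
  have "\<not> Q 25"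
  proof
    assume "Q 25"
    have "list_all (not_all_equal Q)
      [(0, 24, 14, 25), (24, 13, 0, 25), (0, 19, 24, 25), (1, 14, 19, 13), (1, 0, 21, 24),
       (13, 15, 19, 21), (15, 1, 5, 25), (14, 5, 13, 22), (5, 9, 14, 21), (0, 22, 9, 24)]"
      by (rule refutes) code_simp
    then show False
      using \<open>Q 0\<close> \<open>Q 24\<close> \<open>Q 25\<close> by auto
  qed
  have "\<not> Q 1"
  proof
    assume "Q 1"
    have "list_all (not_all_equal Q)
      [(0, 5, 24, 1), (1, 0, 21, 24), (5, 4, 25, 21), (14, 0, 4, 24), (5, 9, 14, 21),
       (1, 19, 9, 4), (0, 22, 9, 24), (19, 5, 2, 22), (5, 22, 19, 23), (6, 4, 23, 0),
       (6, 5, 26, 22), (4, 11, 9, 23), (3, 14, 11, 6), (2, 0, 26, 3)]"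
      by (rule refutes) code_simp
    then show False
      using \<open>Q 0\<close> \<open>Q 24\<close> \<open>\<not> Q 25\<close> \<open>Q 1\<close> by auto
  qed
  have "Q 26"
  proof (rule ccontr)
    assume "\<not> Q 26"
    have "list_all (not_all_equal Q)
      [(25, 7, 1, 26), (1, 20, 25, 26), (1, 25, 15, 26), (2, 15, 20, 7), (2, 1, 22, 25),
       (7, 16, 20, 22), (16, 2, 6, 26), (2, 26, 16, 27), (0, 6, 27, 23), (6, 10, 15, 22),
       (1, 23, 10, 25)]"
      by (rule refutes) code_simp
    then show False
      using \<open>Q 0\<close> \<open>Q 24\<close> \<open>\<not> Q 25\<close> \<open>\<not> Q 1\<close> \<open>\<not> Q 26\<close> by auto
  qed
  have "\<not> Q 2"
  proof
    assume "Q 2"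
    have "list_all (not_all_equal Q)
      [(2, 0, 26, 3), (2, 24, 11, 26), (3, 18, 1, 11), (18, 2, 10, 26), (1, 23, 10, 25),
       (6, 18, 23, 24), (3, 14, 11, 6), (2, 14, 26, 27), (14, 0, 4, 24), (3, 1, 27, 4)]"
      by (rule refutes) code_simp
    then show False
      using \<open>Q 0\<close> \<open>Q 24\<close> \<open>\<not> Q 25\<close> \<open>\<not> Q 1\<close> \<open>Q 26\<close> \<open>Q 2\<close> by auto
  qed
  have "list_all (not_all_equal Q)
    [(1, 6, 25, 2), (2, 1, 22, 25), (6, 5, 26, 22), (15, 1, 5, 25), (6, 10, 15, 22),
     (2, 20, 10, 5), (6, 23, 20, 24), (1, 23, 10, 25)]"
    by (rule refutes) code_simp
  then show False
    using \<open>Q 0\<close> \<open>Q 24\<close> \<open>\<not> Q 25\<close> \<open>\<not> Q 1\<close> \<open>Q 26\<close> \<open>\<not> Q 2\<close> by auto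
qed

theorem lemma4p1:
  "\<exists>(V :: nat set) (B :: nat path4 set) x y.
     P4_system 28 V B \<and> strongly_equitably_chromatic 2 V B \<and>
     x \<in> V \<and> y \<in> V \<and> x \<noteq> y \<and>
     (\<forall>c. colouring 2 V B c \<longrightarrow> c x \<noteq> c y)"
proof (intro exI conjI allI impI)
  let ?V = "{..<28} :: nat set" and ?B = "set paths28"
  let ?c = "\<lambda>v :: nat. if v < 14 then 0 else 1 :: nat"
  show "P4_system 28 ?V ?B"
    by (rule paths28_system)
  have "colour_class ?V ?c 0 = {..<14}" "colour_class ?V ?c 1 = {14..<28}"
    by (auto simp: colour_class_def)
  then have "strongly_equitable 2 ?V ?c"
    by (simp add: strongly_equitable_def less_2_cases_iff all_conj_distrib)
  then show "strongly_equitably_chromatic 2 ?V ?B"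
    using paths28_colouring not_1_colourable[OF paths28_system]
    by (auto simp: strongly_equitably_chromatic_def chromatic_def colourable_def)
  show "c 0 \<noteq> c 24" if c: "colouring 2 ?V ?B c" for c
  proof -
    have "c 24 \<noteq> c 0"
    \<comment> \<open>Here \<open>Q\<close> is \<open>\<lambda>v. c v = c 0\<close>, so the premise
      \<open>Q 0\<close> holds by reflexivity.\<close>
    proof (rule paths28_separates_0_24)
      show "not_all_equal (\<lambda>v. c v = c 0) p" if "p \<in> ?B" for p
        using c that paths28_verts by (intro colouring_2_not_all_equal) auto
    qed simp
    then show ?thesis
      by simp
  qed
qed auto

end
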